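(* Let $\alpha,\beta>0$, let $p\in(0,1]$, and let $X$ be a nonnegative random variable with $0<\mathbf{E}[X^\beta]<\infty$. Let $X^*$ have the $(\alpha,\beta)$-generalized equilibrium distribution of $X$, and suppose that $X^*\preceq_{\overline{p}} X$, i.e. $\mathbf{P}[X^*>s]\le \mathbf{P}[X>s]/p$ for all $s\in\mathbb{R}$. Let $\mu=\bigl(\frac{\beta}{\alpha}\mathbf{E}X^\beta\bigr)^{1/\beta}$. If $\alpha\neq\beta$, then for every $t\ge 1$, $$\mathbf{P}[X\ge \mu t]\le t^\alpha e^{2-pt^\beta}.$$ If $\alpha=\beta$, then for every $t>0$, $$\mathbf{P}[X\ge \mu t]\le e^{1-pt^\beta}.$$
   Context: For a nonnegative random variable $X$ with $0<\mathbf{E}[X^\beta]<\infty$, the $\beta$-power bias transform $X^{(\beta)}$ is a random variable whose law is determined by $\mathbf{E}[X^\beta]\,\mathbf{E}[f(X^{(\beta)})]=\mathbf{E}[X^\beta f(X)]$ for all bounded measurable $f$. A random variable $X^*$ has the $(\alpha,\beta)$-generalized equilibrium distribution of $X$ if $X^*$ is equal in law to $V_\alpha X^{(\beta)}$, where $V_\alpha$ has density $\alpha x^{\alpha-1}$ on $[0,1]$ and is independent of $X^{(\beta)}$. *)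

theory Defs
  imports "HOL-Probability.Probability"
begin

text \<open>
  Random variables that enter a statement only through their laws may live on different
  probability spaces, so every notion below carries the underlying spaces explicitly.
\<close>

definition has_power_bias_law ::
  "real \<Rightarrow> 'a measure \<Rightarrow> ('a \<Rightarrow> real) \<Rightarrow> 'b measure \<Rightarrow> ('b \<Rightarrow> real) \<Rightarrow> bool" where
  "has_power_bias_law \<beta> M X K Y \<longleftrightarrow>
     Y \<in> borel_measurable K \<and>
     (\<forall>f :: real \<Rightarrow> real. f \<in> borel_measurable borel \<longrightarrow> bounded (range f) \<longrightarrow>
        (\<integral>\<omega>. X \<omega> powr \<beta> \<partial>M) * (\<integral>\<omega>. f (Y \<omega>) \<partial>K) = (\<integral>\<omega>. X \<omega> powr \<beta> * f (X \<omega>) \<partial>M))"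

text \<open>
  \<open>V\<close> and \<open>Y\<close> are the factors \<open>V\<^sub>\<alpha>\<close> and \<open>X\<^bsup>(\<beta>)\<^esup>\<close>. Taking their common space
  to have underlying type \<open>real \<times> real\<close> loses nothing: only their joint law matters, and that
  is realised by the two coordinate projections.
\<close>

definition has_generalized_equilibrium_law ::
  "real \<Rightarrow> real \<Rightarrow> 'a measure \<Rightarrow> ('a \<Rightarrow> real) \<Rightarrow> 'b measure \<Rightarrow> ('b \<Rightarrow> real) \<Rightarrow> bool" where
  "has_generalized_equilibrium_law \<alpha> \<beta> M X N Z \<longleftrightarrow>
     Z \<in> borel_measurable N \<and>
     (\<exists>(K :: (real \<times> real) measure) V Y.
        prob_space K \<and>
        distributed K lborel V (\<lambda>x. ennreal (\<alpha> * x powr (\<alpha> - 1) * indicator {0..1} x)) \<and>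
        has_power_bias_law \<beta> M X K Y \<and>
        prob_space.indep_var K borel V borel Y \<and>
        distr N borel Z = distr K borel (\<lambda>\<omega>. V \<omega> * Y \<omega>))"

definition stochastically_dominated ::
  "real \<Rightarrow> 'b measure \<Rightarrow> ('b \<Rightarrow> real) \<Rightarrow> 'a measure \<Rightarrow> ('a \<Rightarrow> real) \<Rightarrow> bool" where
  "stochastically_dominated p N Z M X \<longleftrightarrow>
     (\<forall>s. \<P>(\<omega> in N. Z \<omega> > s) \<le> \<P>(\<omega> in M. X \<omega> > s) / p)"

end

theory Submission imports Defs begin

text \<open>
  Put \<open>a = \<alpha> / \<beta>\<close> and \<open>Z = (X / \<mu>) powr \<beta>\<close>, so that \<open>E Z = a\<close>. In this normalisation the tail of the
  equilibrium law is \<open>K x = E [Z powr (1 - a) * max 0 (Z powr a - x powr a)] / a\<close>, a convex function of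
  \<open>x powr a\<close>. Its supporting lines, together with \<open>p * K x \<le> P [Z > x]\<close>, give the differential
  inequality \<open>K' \<le> (max 0 (a - 1) / x - p) * K\<close> in integrated form, hence
  \<open>x powr (- max 0 (a - 1)) * exp (p * x) * K x\<close> is decreasing. Finally \<open>P [Z \<ge> x]\<close> is bounded by \<open>K y\<close>
  through Markov's inequality, with the choice \<open>y = x - 1 / p\<close>.
\<close>

section \<open>Gronwall's inequality for secants\<close>

text \<open>
  Gronwall's inequality for a function \<open>K\<close> that need not be differentiable: only secants with respect
  to \<open>g\<close> are controlled. On short intervals the increments of \<open>K w\<close> are at most \<open>\<epsilon>\<close> times those of \<open>g\<close>,
  and such estimates add up.
\<close>

lemma gronwall_secant:
  fixes K g g' h w :: "real \<Rightarrow> real"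
  assumes "a \<le> b"
    and g: "\<And>x. a \<le> x \<Longrightarrow> x \<le> b \<Longrightarrow> (g has_real_derivative g' x) (at x)"
    and g'_pos: "\<And>x. a \<le> x \<Longrightarrow> x \<le> b \<Longrightarrow> 0 < g' x"
    and w: "\<And>x. a \<le> x \<Longrightarrow> x \<le> b \<Longrightarrow> (w has_real_derivative g' x * (h x * w x)) (at x)"
    and h: "continuous_on {a..b} h"
    and w_nonneg: "\<And>x. a \<le> x \<Longrightarrow> x \<le> b \<Longrightarrow> 0 \<le> w x"
    and K: "\<And>x. a \<le> x \<Longrightarrow> x \<le> b \<Longrightarrow> 0 \<le> K x \<and> K x \<le> 1"
    and secant: "\<And>x y. a \<le> x \<Longrightarrow> x \<le> y \<Longrightarrow> y \<le> b \<Longrightarrow> K y * (1 + (g y - g x) * h y) \<le> K x"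
  shows "K b * w b \<le> K a * w a"
proof (rule field_le_epsilon)
  fix e :: real assume "0 < e"
  have w_cont: "continuous_on {a..b} w"
    by (meson atLeastAtMost_iff continuous_at_imp_continuous_on DERIV_isCont w)
  have g_mono: "g x \<le> g y" if "a \<le> x" "x \<le> y" "y \<le> b" for x y
    by (rule DERIV_nonneg_imp_nondecreasing[OF that(2)])
       (use that g g'_pos in \<open>meson less_imp_le order_trans\<close>)
  \<comment> \<open>The error summed over all of \<open>[a, b]\<close> will be
    \<open>\<epsilon> * (g b - g a)\<close>, which this scaling keeps below \<open>e\<close>; the
    \<open>+ 1\<close> keeps the denominator positive when \<open>g a = g b\<close>.\<close>
  define \<epsilon> where "\<epsilon> = e / (g b - g a + 1)"
  have "g a \<le> g b"
    using g_mono \<open>a \<le> b\<close> by simp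
  then have "0 < \<epsilon>"
    using \<open>0 < e\<close> by (simp add: \<epsilon>_def)
  have "bounded (w ` {a..b})"
    using w_cont by (simp add: compact_continuous_image compact_imp_bounded)
  then obtain W where "0 < W" and W: "\<And>x. x \<in> {a..b} \<Longrightarrow> \<bar>w x\<bar> \<le> W"
    unfolding bounded_pos by (auto simp: image_iff)
  have "uniformly_continuous_on {a..b} h"
    using h by (simp add: compact_uniformly_continuous)
  moreover have "0 < \<epsilon> / (2 * W)"
    using \<open>0 < \<epsilon>\<close> \<open>0 < W\<close> by simp
  ultimately obtain d1 where "0 < d1"
    and d1: "\<And>x y. x \<in> {a..b} \<Longrightarrow> y \<in> {a..b} \<Longrightarrow> dist y x < d1 \<Longrightarrow> dist (h y) (h x) < \<epsilon> / (2 * W)"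
    unfolding uniformly_continuous_on_def by metis
  have "uniformly_continuous_on {a..b} (\<lambda>x. h x * w x)"
    using h w_cont by (intro compact_uniformly_continuous continuous_on_mult) auto
  then obtain d2 where "0 < d2"
    and d2: "\<And>x y. x \<in> {a..b} \<Longrightarrow> y \<in> {a..b} \<Longrightarrow> dist y x < d2
      \<Longrightarrow> dist (h y * w y) (h x * w x) < \<epsilon> / 2"
    unfolding uniformly_continuous_on_def using \<open>0 < \<epsilon>\<close> by (metis half_gt_zero)
  \<comment> \<open>If \<open>h\<close> were constant and \<open>w\<close> were frozen at
    \<open>x\<close>, the secant bound would cancel the growth of \<open>w\<close> exactly. Uniform
    continuity of \<open>h\<close> and of \<open>h * w\<close> limits the true deviation to
    \<open>\<epsilon>\<close> per unit of \<open>g\<close>.\<close>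
  have short: "K y * w y - K x * w x \<le> \<epsilon> * (g y - g x)"
    if xy: "a \<le> x" "x \<le> y" "y \<le> b" "y - x < min d1 d2" for x y
  proof (cases "x = y")
    case False
    then have "x < y"
      using xy by simp
    \<comment> \<open>Cauchy's mean value theorem measures the increment of \<open>w\<close>
      directly against that of \<open>g\<close>, the quantity in which the secant hypothesis is
      stated.\<close>
    have "\<exists>c. x < c \<and> c < y \<and> (w y - w x) * g' c = (g y - g x) * (g' c * (h c * w c))"
      using \<open>x < y\<close>
    proof (rule GMVT')
      fix z
      show "isCont w z" "isCont g z" if "x \<le> z" "z \<le> y"
        using that xy by (auto intro: DERIV_isCont[OF g] DERIV_isCont[OF w])
      show "DERIV g z :> g' z" "DERIV w z :> g' z * (h z * w z)" if "x < z" "z < y"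
        using that xy by (auto intro: g w)
    qed
    then obtain c where c: "x < c" "c < y"
      and eq: "(w y - w x) * g' c = (g y - g x) * (g' c * (h c * w c))"
      by blast
    have "0 < g' c"
      using g'_pos c xy by simp
    then have dw: "w y - w x = (g y - g x) * (h c * w c)"
      using eq by (metis less_irrefl mult.commute mult.left_commute mult_left_cancel)
    \<comment> \<open>The gap between \<open>h c * w c\<close> and \<open>h y * w x\<close> is split
      at \<open>h x * w x\<close>, each half costing at most \<open>\<epsilon> / 2\<close>.\<close>
    have "\<bar>h c * w c - h x * w x\<bar> < \<epsilon> / 2"
      using d2[of x c] c xy by (simp add: dist_real_def)
    moreover have "\<bar>h y - h x\<bar> * \<bar>w x\<bar> \<le> \<epsilon> / (2 * W) * W"
      using d1[of x y] W[of x] xy by (intro mult_mono) (auto simp: dist_real_def)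
    then have "\<bar>h y * w x - h x * w x\<bar> \<le> \<epsilon> / 2"
      using \<open>0 < W\<close> by (simp add: abs_mult[symmetric] left_diff_distrib)
    ultimately have close: "h c * w c - h y * w x \<le> \<epsilon>"
      by linarith
    have gxy: "0 \<le> g y - g x"
      using g_mono xy by simp
    have "K y * (1 + (g y - g x) * h y) * w x \<le> K x * w x"
      using secant[of x y] w_nonneg[of x] xy by (intro mult_right_mono) auto
    then have "K y * w y - K x * w x \<le> K y * (w y - w x - (g y - g x) * h y * w x)"
      by (simp add: algebra_simps)
    also have "w y - w x - (g y - g x) * h y * w x = (g y - g x) * (h c * w c - h y * w x)"
      by (simp add: dw algebra_simps)
    also have "K y * \<dots> \<le> K y * ((g y - g x) * \<epsilon>)"
      using K[of y] xy gxy close by (intro mult_left_mono) auto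
    also have "\<dots> \<le> 1 * ((g y - g x) * \<epsilon>)"
      using K[of y] xy gxy \<open>0 < \<epsilon>\<close> by (intro mult_right_mono) auto
    finally show ?thesis
      by (simp add: mult.commute)
  qed simp
  \<comment> \<open>The estimate is additive over adjacent intervals, so bisection carries it from
    short intervals to \<open>[a, b]\<close>. The guards are there because the short intervals
    around a point may stick out of \<open>[a, b]\<close>.\<close>
  define P where "P x y \<longleftrightarrow> (a \<le> x \<longrightarrow> y \<le> b \<longrightarrow> K y * w y - K x * w x \<le> \<epsilon> * (g y - g x))" for x y
  have "P a b"
    using \<open>a \<le> b\<close>
  proof (induction rule: Bolzano)
    case (trans x y z)
    then show ?case by (auto simp: P_def algebra_simps)
  next
    case (local x)
    have "P y z" if "y \<le> x" "x \<le> z" "z - y < min d1 d2" for y z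
      unfolding P_def using that by (intro impI short) auto
    then show ?case
      using \<open>0 < d1\<close> \<open>0 < d2\<close> by (intro exI[of _ "min d1 d2"]) auto
  qed
  then have "K b * w b - K a * w a \<le> \<epsilon> * (g b - g a)"
    by (simp add: P_def)
  also have "\<dots> \<le> \<epsilon> * (g b - g a + 1)"
    using \<open>0 < \<epsilon>\<close> by simp
  also have "\<dots> = e"
    using \<open>g a \<le> g b\<close> by (simp add: \<epsilon>_def)
  finally show "K b * w b \<le> K a * w a + e"
    by simp
qed

section \<open>The kernel of the equilibrium tail and its pointwise inequalities\<close>

text \<open>For \<open>0 < x < z\<close> this is \<open>z * (1 - (x / z) powr a)\<close>, that is
  \<open>z\<close> times the probability that a variable with density
  \<open>a * v powr (a - 1)\<close> on \<open>[0, 1]\<close> exceeds \<open>x / z\<close>. The form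
  chosen is affine in \<open>x powr a\<close> as long as \<open>x < z\<close>.\<close>

definition excess :: "real \<Rightarrow> real \<Rightarrow> real \<Rightarrow> real" where
  "excess a x z = (if x < z then z - x powr a * z powr (1 - a) else 0)"

lemma measurable_excess [measurable]: "excess a x \<in> borel_measurable borel"
  unfolding excess_def by measurable

lemma excess_eq: "0 < z \<Longrightarrow> excess a x z = (if x < z then z powr (1 - a) * (z powr a - x powr a) else 0)"
  by (simp add: excess_def right_diff_distrib powr_add[symmetric])

lemma excess_nonneg: "0 < a \<Longrightarrow> 0 \<le> x \<Longrightarrow> 0 \<le> excess a x z"
  by (cases "0 < z") (auto simp: excess_eq powr_mono2, simp add: excess_def)

lemma excess_le: "0 \<le> z \<Longrightarrow> excess a x z \<le> z"
  by (simp add: excess_def)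

text \<open>In the variable \<open>x powr a\<close> the kernel falls with slope
  \<open>z powr (1 - a)\<close> until it vanishes at \<open>x = z\<close>. That slope is bounded
  below by an expression in the indicator of \<open>x < z\<close> and the kernel itself, so that
  taking expectations leaves only the tail probability and the equilibrium tail.\<close>

lemma excess_secant:
  fixes a :: real
  defines "\<kappa> \<equiv> max 0 (1 - 1 / a)"
  assumes "0 < a" "0 \<le> y" "y \<le> x" "0 < x"
  shows "excess a x z + (x powr a - y powr a) * x powr (1 - a) *
    (indicator {x<..} z - \<kappa> / x * excess a x z) \<le> excess a y z"
proof (cases "x < z")
  case True
  \<comment> \<open>By homogeneity the slope bound, divided by \<open>x powr (1 - a)\<close>,
    depends on \<open>z / x\<close> alone.\<close>
  define r where "r = z / x"
  have z: "z = x * r" and r: "1 < r"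
    using True assms by (simp_all add: r_def)
  have dxy: "0 \<le> x powr a - y powr a"
    using assms by (simp add: powr_mono2)
  have one: "1 - \<kappa> * (r - r powr (1 - a)) \<le> r powr (1 - a)"
  proof (cases "a \<le> 1")
    case True
    then have "\<kappa> = 0"
      using \<open>0 < a\<close> by (simp add: \<kappa>_def max_def field_simps)
    then show ?thesis
      using r True by (simp add: ge_one_powr_ge_zero)
  next
    case False
    then have \<kappa>: "\<kappa> = 1 - 1 / a"
      by (simp add: \<kappa>_def max_def)
    \<comment> \<open>weighted AM-GM for \<open>r powr (1 - a)\<close> and \<open>r\<close> with weights \<open>1/a\<close> and \<open>1 - 1/a\<close>,
      whose weighted geometric mean is 1\<close>
    have "1 + (1 - a) * ln r \<le> r powr (1 - a)" "1 + ln r \<le> r"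
      using r exp_ge_add_one_self[of "(1 - a) * ln r"] exp_ge_add_one_self[of "ln r"]
      by (simp_all add: powr_def)
    then have "(1 / a) * (1 + (1 - a) * ln r) + (1 - 1 / a) * (1 + ln r)
        \<le> (1 / a) * r powr (1 - a) + (1 - 1 / a) * r"
      using False by (intro add_mono mult_left_mono) auto
    moreover have "(1 / a) * (1 + (1 - a) * ln r) + (1 - 1 / a) * (1 + ln r) = 1"
      using \<open>0 < a\<close> by (simp add: field_simps)
    ultimately show ?thesis
      by (simp add: \<kappa> algebra_simps)
  qed
  have ex: "excess a x z = x * (r - r powr (1 - a))"
    using True r assms
    by (simp add: excess_def z powr_mult right_diff_distrib mult.assoc[symmetric] powr_add[symmetric])
  have "excess a y z - excess a x z = (x powr a - y powr a) * (x powr (1 - a) * r powr (1 - a))"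
  proof -
    have "y < z"
      using True assms by simp
    then show ?thesis
      using True r assms by (simp add: excess_def z powr_mult algebra_simps)
  qed
  also have "\<dots> \<ge> (x powr a - y powr a) * (x powr (1 - a) * (1 - \<kappa> * (r - r powr (1 - a))))"
    by (intro mult_left_mono one dxy powr_ge_zero)
  finally show ?thesis
    using True \<open>0 < x\<close> by (simp add: ex algebra_simps)
next
  case False
  then show ?thesis
    using excess_nonneg[of a y z] assms by (simp add: excess_def[of a x z])
qed

text \<open>The kernel is nondecreasing in \<open>z\<close>, being a product of the nonnegative
  nondecreasing factors \<open>z\<close> and \<open>1 - (y / z) powr a\<close>. This is the
  pointwise form of Markov's inequality used later.\<close>

lemma excess_tail:
  assumes "0 < a" "0 \<le> y" "y < x"
  shows "indicator {x..} z * excess a y x \<le> excess a y z"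
proof (cases "x \<le> z")
  case True
  have "(y / z) powr a \<le> (y / x) powr a"
    using True assms by (intro powr_mono2 divide_left_mono) auto
  then have "x * (1 - (y / x) powr a) \<le> z * (1 - (y / z) powr a)"
    using True assms by (intro mult_mono) (auto intro!: powr_le1)
  moreover have "excess a y u = u * (1 - (y / u) powr a)" if "y < u" for u
    using that assms by (simp add: excess_def powr_divide powr_diff right_diff_distrib)
  ultimately show ?thesis
    using True assms by simp
next
  case False
  then show ?thesis
    using assms by (simp add: excess_nonneg)
qed

lemma powr_le_iff_le:
  fixes x y b :: real
  assumes "0 < b" "0 \<le> x" "0 \<le> y"
  shows "x powr b \<le> y powr b \<longleftrightarrow> x \<le> y"
  using assms powr_mono2[of b x y] powr_less_mono2[of b y x] by (metis less_imp_le not_le)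

lemma powr_diff_mean_value:
  fixes a x y :: real
  assumes "0 < y" "y < x"
  obtains c where "y < c" "c < x" "x powr a - y powr a = (x - y) * (a * c powr (a - 1))"
proof -
  have "\<exists>c. y < c \<and> c < x \<and> x powr a - y powr a = (x - y) * (a * c powr (a - 1))"
    using assms by (intro MVT2) (auto intro!: derivative_eq_intros)
  then show thesis
    using that by blast
qed

section \<open>Decay of the normalised equilibrium tail\<close>

text \<open>The equilibrium variable has been eliminated: its tail at \<open>x\<close> is the
  expected kernel divided by \<open>a\<close>, so \<open>dominated\<close> is the stochastic
  domination with denominators cleared.\<close>

locale equilibrium_dominated = prob_space +
  fixes Z :: "'a \<Rightarrow> real" and a p :: real
  assumes measurable_Z [measurable]: "Z \<in> borel_measurable M"
    and Z_nonneg: "AE \<omega> in M. 0 \<le> Z \<omega>"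
    and integrable_Z: "integrable M Z"
    and expectation_Z: "expectation Z = a"
    and a_pos: "0 < a" and p_pos: "0 < p" and p_le_1: "p \<le> 1"
    and dominated: "\<And>x. 0 < x \<Longrightarrow> p * expectation (\<lambda>\<omega>. excess a x (Z \<omega>)) \<le> a * \<P>(\<omega> in M. x < Z \<omega>)"
begin

definition K :: "real \<Rightarrow> real" where
  "K x = expectation (\<lambda>\<omega>. excess a x (Z \<omega>)) / a"

text \<open>The constant of \<open>excess_secant\<close>. Since
  \<open>a * \<kappa> = max 0 (a - 1)\<close>, it yields the exponent of the polynomial factor in
  the decay of \<open>K\<close>.\<close>

definition \<kappa> :: real where
  "\<kappa> = max 0 (1 - 1 / a)"

lemma integrable_excess:
  assumes "0 \<le> x"
  shows "integrable M (\<lambda>\<omega>. excess a x (Z \<omega>))"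
proof (rule Bochner_Integration.integrable_bound[OF integrable_Z])
  show "AE \<omega> in M. norm (excess a x (Z \<omega>)) \<le> norm (Z \<omega>)"
    using Z_nonneg
  proof eventually_elim
    case (elim \<omega>)
    then show ?case
      using excess_nonneg[OF a_pos assms, of "Z \<omega>"] excess_le[OF elim] by simp
  qed
qed measurable

lemma K_nonneg: "0 \<le> x \<Longrightarrow> 0 \<le> K x"
  unfolding K_def using a_pos by (intro divide_nonneg_pos Bochner_Integration.integral_nonneg excess_nonneg)

lemma K_le_1:
  assumes "0 \<le> x"
  shows "K x \<le> 1"
proof -
  have "expectation (\<lambda>\<omega>. excess a x (Z \<omega>)) \<le> expectation Z"
    using Z_nonneg integrable_excess[OF assms] integrable_Z
    by (intro integral_mono_AE) (auto elim!: eventually_mono intro: excess_le)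
  then show ?thesis
    using a_pos by (simp add: K_def expectation_Z)
qed

lemma expectation_indicator:
  assumes [measurable]: "S \<in> sets borel"
  shows "expectation (\<lambda>\<omega>. indicator S (Z \<omega>)) = \<P>(\<omega> in M. Z \<omega> \<in> S)"
proof -
  have "expectation (\<lambda>\<omega>. indicator S (Z \<omega>)) = expectation (indicator {\<omega> \<in> space M. Z \<omega> \<in> S})"
    by (intro Bochner_Integration.integral_cong) (auto simp: indicator_def)
  also have "\<dots> = \<P>(\<omega> in M. Z \<omega> \<in> S)"
    by (simp add: Int_absorb2)
  finally show ?thesis .
qed

text \<open>The expectation of \<open>excess_secant\<close>, with the tail probability eliminated
  through \<open>dominated\<close>. It has the shape of the secant hypothesis of
  \<open>gronwall_secant\<close>, with \<open>x powr a\<close> as \<open>g\<close>.\<close>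

lemma K_secant:
  assumes "0 \<le> y" "y \<le> x" "0 < x"
  shows "K x * (1 + (x powr a - y powr a) * (x powr (1 - a) * (p / a - \<kappa> / x))) \<le> K y"
proof -
  define D where "D = (x powr a - y powr a) * x powr (1 - a)"
  have "0 \<le> D"
    using assms a_pos by (simp add: D_def powr_mono2)
  have int: "integrable M (\<lambda>\<omega>. excess a x (Z \<omega>))" "integrable M (\<lambda>\<omega>. excess a y (Z \<omega>))"
    using assms by (auto intro: integrable_excess)
  have prob: "expectation (\<lambda>\<omega>. indicator {x<..} (Z \<omega>)) = \<P>(\<omega> in M. x < Z \<omega>)"
    using expectation_indicator[of "{x<..}"] by simp
  have ind: "integrable M (\<lambda>\<omega>. indicator {x<..} (Z \<omega>) :: real)"
    by (rule integrable_const_bound[where B = 1]) auto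
  have "expectation (\<lambda>\<omega>. excess a x (Z \<omega>) + D * (indicator {x<..} (Z \<omega>) - \<kappa> / x * excess a x (Z \<omega>)))
      \<le> expectation (\<lambda>\<omega>. excess a y (Z \<omega>))"
    using int ind excess_secant[OF a_pos assms] unfolding D_def \<kappa>_def by (intro integral_mono) auto
  also have "expectation (\<lambda>\<omega>. excess a x (Z \<omega>) + D * (indicator {x<..} (Z \<omega>) - \<kappa> / x * excess a x (Z \<omega>)))
      = a * K x + D * (\<P>(\<omega> in M. x < Z \<omega>) - \<kappa> / x * (a * K x))"
    using int ind a_pos by (simp add: prob K_def)
  finally have "a * K x + D * (\<P>(\<omega> in M. x < Z \<omega>) - \<kappa> / x * (a * K x)) \<le> a * K y"
    using a_pos by (simp add: K_def)
  moreover have "p * K x \<le> \<P>(\<omega> in M. x < Z \<omega>)"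
    using dominated[OF \<open>0 < x\<close>] a_pos by (simp add: K_def field_simps)
  \<comment> \<open>As \<open>D\<close> is nonnegative, the tail probability may be lowered to
    \<open>p * K x\<close>, which leaves an inequality in \<open>K\<close> alone.\<close>
  then have "D * (p * K x - \<kappa> / x * (a * K x)) \<le> D * (\<P>(\<omega> in M. x < Z \<omega>) - \<kappa> / x * (a * K x))"
    using \<open>0 \<le> D\<close> by (intro mult_left_mono) auto
  ultimately have "a * K x + D * (p * K x - \<kappa> / x * (a * K x)) \<le> a * K y"
    by linarith
  then have "a * (K x * (1 + D * (p / a - \<kappa> / x))) \<le> a * K y"
    using a_pos by (simp add: algebra_simps)
  then show ?thesis
    using a_pos by (simp add: D_def mult.assoc)
qed

text \<open>The weight is the integrating factor: its logarithmic derivative is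
  \<open>p - a * \<kappa> / x\<close>, which equals \<open>g' * h\<close> because the powers
  \<open>x powr (a - 1)\<close> and \<open>x powr (1 - a)\<close> cancel.\<close>

lemma K_decay:
  assumes "0 < y" "y \<le> x"
  shows "K x * (x powr (- (a * \<kappa>)) * exp (p * x)) \<le> K y * (y powr (- (a * \<kappa>)) * exp (p * y))"
proof (rule gronwall_secant[where g = "\<lambda>x. x powr a" and g' = "\<lambda>x. a * x powr (a - 1)"
      and h = "\<lambda>x. x powr (1 - a) * (p / a - \<kappa> / x)"])
  fix u assume u: "y \<le> u" "u \<le> x"
  then have "0 < u"
    using assms by simp
  show "((\<lambda>x. x powr a) has_real_derivative a * u powr (a - 1)) (at u)"
    using \<open>0 < u\<close> by (auto intro!: derivative_eq_intros)
  show "0 < a * u powr (a - 1)"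
    using \<open>0 < u\<close> a_pos by simp
  have "a * u powr (a - 1) * (u powr (1 - a) * (p / a - \<kappa> / u))
      = (u powr (a - 1) * u powr (1 - a)) * (p - a * \<kappa> / u)"
    using a_pos by (simp add: right_diff_distrib)
  also have "\<dots> = p - a * \<kappa> / u"
    using \<open>0 < u\<close> by (simp add: powr_add[symmetric])
  finally have coeff: "a * u powr (a - 1) * (u powr (1 - a) * (p / a - \<kappa> / u) * W) = (p - a * \<kappa> / u) * W" for W
    by (simp only: mult.assoc[symmetric])
  show "((\<lambda>x. x powr (- (a * \<kappa>)) * exp (p * x)) has_real_derivative
      a * u powr (a - 1) * (u powr (1 - a) * (p / a - \<kappa> / u) * (u powr (- (a * \<kappa>)) * exp (p * u)))) (at u)"
    unfolding coeff using \<open>0 < u\<close>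
    by (auto intro!: derivative_eq_intros simp: powr_diff algebra_simps)
  show "0 \<le> K u \<and> K u \<le> 1"
    using \<open>0 < u\<close> by (simp add: K_nonneg K_le_1)
next
  show "continuous_on {y..x} (\<lambda>x. x powr (1 - a) * (p / a - \<kappa> / x))"
    using assms by (auto intro!: continuous_intros)
next
  fix u v assume "y \<le> u" "u \<le> v" "v \<le> x"
  then show "K v * (1 + (v powr a - u powr a) * (v powr (1 - a) * (p / a - \<kappa> / v))) \<le> K u"
    using assms by (intro K_secant) auto
qed (use assms in auto)

section \<open>Tail bounds through Markov's inequality\<close>

lemma excess_tail_prob:
  assumes "0 \<le> y" "y < x"
  shows "excess a y x * \<P>(\<omega> in M. x \<le> Z \<omega>) \<le> a * K y"
proof -
  have prob: "expectation (\<lambda>\<omega>. indicator {x..} (Z \<omega>)) = \<P>(\<omega> in M. x \<le> Z \<omega>)"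
    using expectation_indicator[of "{x..}"] by simp
  have "integrable M (\<lambda>\<omega>. indicator {x..} (Z \<omega>) :: real)"
    by (rule integrable_const_bound[where B = 1]) auto
  then have "expectation (\<lambda>\<omega>. indicator {x..} (Z \<omega>) * excess a y x) \<le> expectation (\<lambda>\<omega>. excess a y (Z \<omega>))"
    using assms a_pos by (intro integral_mono integrable_excess excess_tail) auto
  then show ?thesis
    using a_pos by (simp add: prob K_def mult.commute)
qed

text \<open>Here \<open>\<kappa> = 0\<close>, so \<open>K y \<le> exp (- p * y)\<close>. Markov's
  inequality divides \<open>a * K y\<close> by at least \<open>a * (x - y)\<close>, and the shift
  from \<open>y\<close> back to \<open>x\<close> costs the factor \<open>exp 1\<close>.\<close>

lemma tail_bound_le_1:
  assumes "a \<le> 1" "0 < x"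
  shows "\<P>(\<omega> in M. x \<le> Z \<omega>) \<le> exp (1 - p * x)"
proof (cases "p * x \<le> 1")
  case True
  then show ?thesis
    by (intro order_trans[OF prob_le_1]) simp
next
  case False
  \<comment> \<open>This \<open>y\<close> minimises \<open>exp (- p * y) / (x - y)\<close>, the
    bound that decay and Markov's inequality give together.\<close>
  define y where "y = x - 1 / p"
  have y: "0 < y" "y < x" and py: "p * y = p * x - 1"
    using False p_pos by (simp_all add: y_def field_simps)
  have "\<kappa> = 0"
    using assms a_pos by (simp add: \<kappa>_def max_def field_simps)
  \<comment> \<open>\<open>K_decay\<close> starts only from positive points, so the initial value 1
    at the origin is approached from \<open>u > 0\<close> with
    \<open>exp (p * u) \<le> 1 + e\<close>.\<close>
  have "K y * exp (p * y) \<le> 1"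
  proof (rule field_le_epsilon)
    fix e :: real assume "0 < e"
    define u where "u = min y (ln (1 + e) / p)"
    have u: "0 < u" "u \<le> y" "p * u \<le> ln (1 + e)"
      using y p_pos \<open>0 < e\<close> by (auto simp: u_def min_def field_simps)
    have "K y * exp (p * y) \<le> K u * exp (p * u)"
      using K_decay[OF u(1,2)] u y by (simp add: \<open>\<kappa> = 0\<close>)
    also have "\<dots> \<le> 1 * exp (ln (1 + e))"
      using u K_nonneg[of u] K_le_1[of u] by (intro mult_mono) auto
    finally show "K y * exp (p * y) \<le> 1 + e"
      using \<open>0 < e\<close> by simp
  qed
  then have Ky: "K y \<le> exp (1 - p * x)"
    by (simp add: exp_diff py field_simps)
  obtain c where c: "y < c" "c < x" "x powr a - y powr a = (x - y) * (a * c powr (a - 1))"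
    using powr_diff_mean_value[OF y] by metis
  \<comment> \<open>For \<open>a \<le> 1\<close> the derivative of the power is smallest at the
    right end, where it cancels the prefactor \<open>x powr (1 - a)\<close> of the kernel.\<close>
  have "x powr (a - 1) \<le> c powr (a - 1)"
    using c y assms by (intro powr_mono2') auto
  then have "x powr (1 - a) * ((x - y) * (a * x powr (a - 1))) \<le> excess a y x"
    using c y a_pos by (simp add: excess_eq mult_left_mono)
  then have "a / p \<le> excess a y x"
    using y by (simp add: y_def mult_ac powr_add[symmetric])
  then have "a / p * \<P>(\<omega> in M. x \<le> Z \<omega>) \<le> excess a y x * \<P>(\<omega> in M. x \<le> Z \<omega>)"
    by (intro mult_right_mono) auto
  also have "\<dots> \<le> a * K y"
    using y by (intro excess_tail_prob) auto
  finally have "\<P>(\<omega> in M. x \<le> Z \<omega>) \<le> p * K y"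
    using a_pos p_pos by (simp add: field_simps)
  also have "\<dots> \<le> 1 * K y"
    using p_le_1 K_nonneg[of y] y by (intro mult_right_mono) auto
  finally show ?thesis
    using Ky by simp
qed

text \<open>The decay is now started at 1, since its weight contains \<open>y powr (1 - a)\<close>.
  This costs a second factor \<open>exp 1\<close>. The powers of \<open>y\<close> cancel between the
  decay and the Markov denominator, leaving \<open>x powr (a - 1)\<close>.\<close>

lemma tail_bound_ge_1:
  assumes "1 \<le> a" "1 \<le> x"
  shows "\<P>(\<omega> in M. x \<le> Z \<omega>) \<le> x powr a * exp (2 - p * x)"
\<comment> \<open>In this range \<open>y\<close> would drop below 1, but
  \<open>p * x \<le> p + 1 \<le> 2\<close> makes the claimed bound at least 1.\<close>
proof (cases "x < 1 + 1 / p")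
  case True
  then have "p * x \<le> 2"
    using p_pos p_le_1 by (simp add: field_simps)
  then have "1 * 1 \<le> x powr a * exp (2 - p * x)"
    using assms by (intro mult_mono) (auto intro: ge_one_powr_ge_zero)
  then show ?thesis
    by (intro order_trans[OF prob_le_1]) simp
next
  case False
  define y where "y = x - 1 / p"
  have y: "1 \<le> y" "y < x" and py: "p * y = p * x - 1"
    using False p_pos by (simp_all add: y_def field_simps)
  have ak: "a * \<kappa> = a - 1"
    using assms by (simp add: \<kappa>_def max_def field_simps)
  have "K y * (y powr (1 - a) * exp (p * y)) \<le> K 1 * exp p"
    using K_decay[of 1 y] y by (simp add: ak)
  also have "\<dots> \<le> 1 * exp 1"
    using p_le_1 K_nonneg[of 1] K_le_1[of 1] by (intro mult_mono) auto
  finally have Ky: "K y * y powr (1 - a) \<le> exp (2 - p * x)"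
    by (simp add: exp_diff exp_add[symmetric] py field_simps)
  obtain c where c: "y < c" "c < x" "x powr a - y powr a = (x - y) * (a * c powr (a - 1))"
    using powr_diff_mean_value[of y x a] y by auto
  have "y powr (a - 1) \<le> c powr (a - 1)"
    using c y assms by (intro powr_mono2) auto
  then have "x powr (1 - a) * ((x - y) * (a * y powr (a - 1))) \<le> excess a y x"
    using c y a_pos by (simp add: excess_eq mult_left_mono)
  then have "a / p * (x powr (1 - a) * y powr (a - 1)) * \<P>(\<omega> in M. x \<le> Z \<omega>)
      \<le> excess a y x * \<P>(\<omega> in M. x \<le> Z \<omega>)"
    by (intro mult_right_mono) (auto simp: y_def mult_ac)
  also have "\<dots> \<le> a * K y"
    using y by (intro excess_tail_prob) auto
  finally have "x powr (1 - a) * y powr (a - 1) * \<P>(\<omega> in M. x \<le> Z \<omega>) \<le> p * K y"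
    using a_pos p_pos by (simp add: field_simps)
  also have "\<dots> \<le> 1 * K y"
    using p_le_1 K_nonneg[of y] y by (intro mult_right_mono) auto
  finally have "x powr (1 - a) * y powr (a - 1) * \<P>(\<omega> in M. x \<le> Z \<omega>) * (x powr (a - 1) * y powr (1 - a))
      \<le> K y * (x powr (a - 1) * y powr (1 - a))"
    by (intro mult_right_mono) auto
  moreover have "x powr (1 - a) * x powr (a - 1) = 1" "y powr (a - 1) * y powr (1 - a) = 1"
    using y by (simp_all add: powr_add[symmetric])
  then have "x powr (1 - a) * y powr (a - 1) * P * (x powr (a - 1) * y powr (1 - a)) = P" for P
    by algebra
  ultimately have "\<P>(\<omega> in M. x \<le> Z \<omega>) \<le> x powr (a - 1) * (K y * y powr (1 - a))"
    by (metis mult.left_commute)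
  also have "\<dots> \<le> x powr a * exp (2 - p * x)"
    using Ky y K_nonneg[of y] by (intro mult_mono powr_mono) auto
  finally show ?thesis .
qed

end

section \<open>Tail of the generalized equilibrium law\<close>

lemma power_density_tail:
  fixes V :: "'b \<Rightarrow> real"
  assumes V: "distributed K lborel V (\<lambda>x. ennreal (\<alpha> * x powr (\<alpha> - 1) * indicator {0..1} x))"
    and "0 < \<alpha>" "0 < c"
  shows "measure K {\<omega> \<in> space K. c < V \<omega>} = (if c < 1 then 1 - c powr \<alpha> else 0)"
proof -
  have "emeasure K {\<omega> \<in> space K. c < V \<omega>} = emeasure K (V -` {c<..} \<inter> space K)"
    by (intro arg_cong[where f = "emeasure K"]) auto
  also have "\<dots> = (\<integral>\<^sup>+x. ennreal (\<alpha> * x powr (\<alpha> - 1) * indicator {0..1} x) * indicator {c<..} x \<partial>lborel)"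
    by (rule distributed_emeasure[OF V]) simp
  \<comment> \<open>Adding the null point \<open>c\<close> gives a closed interval for the
    fundamental theorem of calculus; \<open>0 < c\<close> keeps it away from the possible
    singularity of the density at 0.\<close>
  also have "\<dots> = (\<integral>\<^sup>+x. (if c < 1 then ennreal (\<alpha> * x powr (\<alpha> - 1)) * indicator {c..1} x else 0) \<partial>lborel)"
    using AE_lborel_singleton[of c] \<open>0 < c\<close>
    by (intro nn_integral_cong_AE) (auto elim!: eventually_mono simp: indicator_def)
  also have "\<dots> = (if c < 1 then ennreal (1 - c powr \<alpha>) else 0)"
  proof (cases "c < 1")
    case True
    have "(\<integral>\<^sup>+x. ennreal (\<alpha> * x powr (\<alpha> - 1)) * indicator {c..1} x \<partial>lborel)
        = ennreal (1 powr \<alpha> - c powr \<alpha>)"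
    proof (rule nn_integral_FTC_Icc)
      show "((\<lambda>x. x powr \<alpha>) has_real_derivative \<alpha> * x powr (\<alpha> - 1)) (at x)" if "x \<in> {c..1}" for x
        using that \<open>0 < c\<close> by (auto intro!: derivative_eq_intros)
    qed (use True \<open>0 < \<alpha>\<close> in auto)
    then show ?thesis
      using True by simp
  qed simp
  finally show ?thesis
    using \<open>0 < \<alpha>\<close> \<open>0 < c\<close> by (auto simp: measure_def powr_le1)
qed

text \<open>By independence and Fubini the tail of \<open>V * Y\<close> is the mean of
  \<open>f (Y)\<close>, where \<open>f y\<close> is the probability that \<open>V * y\<close>
  exceeds \<open>s\<close>. The bias identity moves this mean to \<open>X\<close>, and the tail of
  \<open>V\<close> evaluates \<open>f\<close>.\<close>

lemma generalized_equilibrium_tail: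
  fixes X :: "'a \<Rightarrow> real" and Z :: "'b \<Rightarrow> real"
  assumes law: "has_generalized_equilibrium_law \<alpha> \<beta> M X N Z"
    and nonneg: "AE \<omega> in M. 0 \<le> X \<omega>" and [measurable]: "X \<in> borel_measurable M"
    and "0 < \<alpha>" "0 < s"
  shows "(\<integral>\<omega>. X \<omega> powr \<beta> \<partial>M) * \<P>(\<omega> in N. s < Z \<omega>)
    = (\<integral>\<omega>. X \<omega> powr \<beta> * (if s < X \<omega> then 1 - (s / X \<omega>) powr \<alpha> else 0) \<partial>M)"
proof -
  have [measurable]: "Z \<in> borel_measurable N"
    using law by (simp add: has_generalized_equilibrium_law_def)
  obtain K :: "(real \<times> real) measure" and V Y where "prob_space K"
    and V: "distributed K lborel V (\<lambda>x. ennreal (\<alpha> * x powr (\<alpha> - 1) * indicator {0..1} x))"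
    and Y: "has_power_bias_law \<beta> M X K Y"
    and ind: "prob_space.indep_var K borel V borel Y"
    and Z: "distr N borel Z = distr K borel (\<lambda>\<omega>. V \<omega> * Y \<omega>)"
    using law unfolding has_generalized_equilibrium_law_def by blast
  interpret K: prob_space K by fact
  have [measurable]: "V \<in> borel_measurable K" "Y \<in> borel_measurable K"
    and joint: "distr K borel V \<Otimes>\<^sub>M distr K borel Y = distr K (borel \<Otimes>\<^sub>M borel) (\<lambda>\<omega>. (V \<omega>, Y \<omega>))"
    using ind by (simp_all add: K.indep_var_distribution_eq)
  interpret V: prob_space "distr K borel V" by (rule K.prob_space_distr) simp
  interpret Y: prob_space "distr K borel Y" by (rule K.prob_space_distr) simp
  interpret VY: pair_prob_space "distr K borel V" "distr K borel Y" ..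
  \<comment> \<open>The test function for the bias identity. It is bounded by 1, and measurable
    because it gives the slice measures of \<open>Q\<close>.\<close>
  define f where "f y = K.prob {\<omega> \<in> space K. s < V \<omega> * y}" for y
  define Q where "Q = {vy :: real \<times> real. s < fst vy * snd vy}"
  have Q: "Q \<in> sets (borel \<Otimes>\<^sub>M borel)"
  proof -
    have "{vy \<in> space (borel \<Otimes>\<^sub>M borel). s < fst vy * snd vy} \<in> sets (borel \<Otimes>\<^sub>M borel)"
      by measurable
    then show ?thesis
      by (simp add: Q_def space_pair_measure)
  qed
  then have Q': "Q \<in> sets (distr K borel V \<Otimes>\<^sub>M distr K borel Y)"
    by (simp cong: sets_pair_measure_cong)
  have slice: "emeasure (distr K borel V) ((\<lambda>v. (v, y)) -` Q) = ennreal (f y)" for y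
  proof -
    have "(\<lambda>v. (v, y)) -` Q = {v. s < v * y}"
      by (auto simp: Q_def)
    then show ?thesis
      by (auto simp: emeasure_distr f_def K.emeasure_eq_measure intro!: arg_cong[where f = K.prob])
  qed
  have "(\<lambda>y. ennreal (f y)) \<in> borel_measurable borel"
    using VY.measurable_emeasure_Pair2[OF Q'] by (simp add: slice)
  then have "(\<lambda>y. enn2real (ennreal (f y))) \<in> borel_measurable borel"
    by measurable
  then have f_meas [measurable]: "f \<in> borel_measurable borel"
    by (simp add: f_def[abs_def])
  have f_nonneg: "0 \<le> f y" for y
    by (simp add: f_def)
  have f_bound: "bounded (range f)"
    by (intro boundedI[where B = 1]) (auto simp: f_def)
  have "\<P>(\<omega> in N. s < Z \<omega>) = measure (distr N borel Z) {s<..}"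
    by (auto simp: measure_distr intro!: arg_cong[where f = "measure N"])
  also have "\<dots> = K.prob {\<omega> \<in> space K. s < V \<omega> * Y \<omega>}"
    unfolding Z by (auto simp: measure_distr intro!: arg_cong[where f = K.prob])
  also have "\<dots> = measure (distr K borel V \<Otimes>\<^sub>M distr K borel Y) Q"
    unfolding joint using Q
    by (auto simp: measure_distr Q_def intro!: arg_cong[where f = K.prob])
  also have "\<dots> = enn2real (\<integral>\<^sup>+y. ennreal (f y) \<partial>distr K borel Y)"
    using VY.emeasure_pair_measure_alt2[OF Q'] by (simp add: slice measure_def)
  also have "\<dots> = (\<integral>y. f y \<partial>distr K borel Y)"
    by (rule integral_eq_nn_integral[symmetric]) (simp_all add: f_nonneg)
  also have "\<dots> = (\<integral>\<omega>. f (Y \<omega>) \<partial>K)"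
    by (rule integral_distr) simp_all
  finally have "\<P>(\<omega> in N. s < Z \<omega>) = (\<integral>\<omega>. f (Y \<omega>) \<partial>K)" .
  then have "(\<integral>\<omega>. X \<omega> powr \<beta> \<partial>M) * \<P>(\<omega> in N. s < Z \<omega>) = (\<integral>\<omega>. X \<omega> powr \<beta> * f (X \<omega>) \<partial>M)"
    using Y f_meas f_bound unfolding has_power_bias_law_def by simp
  also have "\<dots> = (\<integral>\<omega>. X \<omega> powr \<beta> * (if s < X \<omega> then 1 - (s / X \<omega>) powr \<alpha> else 0) \<partial>M)"
  proof (rule integral_cong_AE)
    show "AE \<omega> in M. X \<omega> powr \<beta> * f (X \<omega>)
        = X \<omega> powr \<beta> * (if s < X \<omega> then 1 - (s / X \<omega>) powr \<alpha> else 0)"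
      using nonneg
    proof eventually_elim
      case (elim \<omega>)
      show ?case
      \<comment> \<open>At 0 the weight \<open>X \<omega> powr \<beta>\<close> vanishes, so the
        quotient \<open>s / X \<omega>\<close> is needed only for positive values.\<close>
      proof (cases "X \<omega> = 0")
        case False
        then have "0 < X \<omega>"
          using elim by simp
        then have "f (X \<omega>) = K.prob {\<eta> \<in> space K. s / X \<omega> < V \<eta>}"
          by (simp add: f_def field_simps)
        also have "\<dots> = (if s < X \<omega> then 1 - (s / X \<omega>) powr \<alpha> else 0)"
          using power_density_tail[OF V \<open>0 < \<alpha>\<close>, of "s / X \<omega>"] \<open>0 < s\<close> \<open>0 < X \<omega>\<close> by simp
        finally show ?thesis by simp
      qed simp
    qed
  qed measurable
  finally show ?thesis .
qed

section \<open>Passage from \<open>X\<close> to the normalised variable\<close>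

theorem theorem3:
  fixes M :: "'a measure" and N :: "'b measure"
    and X :: "'a \<Rightarrow> real" and Xstar :: "'b \<Rightarrow> real"
    and \<alpha> \<beta> p \<mu> :: real
  assumes "prob_space M" and "prob_space N"
    and "\<alpha> > 0" and "\<beta> > 0" and "0 < p" and "p \<le> 1"
    and "X \<in> borel_measurable M" and "AE \<omega> in M. X \<omega> \<ge> 0"
    and "integrable M (\<lambda>\<omega>. X \<omega> powr \<beta>)" and "0 < (\<integral>\<omega>. X \<omega> powr \<beta> \<partial>M)"
    and "has_generalized_equilibrium_law \<alpha> \<beta> M X N Xstar"
    and "stochastically_dominated p N Xstar M X"
    and "\<mu> = (\<beta> / \<alpha> * (\<integral>\<omega>. X \<omega> powr \<beta> \<partial>M)) powr (1 / \<beta>)"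
  shows "(\<alpha> \<noteq> \<beta> \<longrightarrow> (\<forall>t\<ge>1. \<P>(\<omega> in M. X \<omega> \<ge> \<mu> * t) \<le> t powr \<alpha> * exp (2 - p * t powr \<beta>))) \<and>
         (\<alpha> = \<beta> \<longrightarrow> (\<forall>t>0. \<P>(\<omega> in M. X \<omega> \<ge> \<mu> * t) \<le> exp (1 - p * t powr \<beta>)))"
proof -
  interpret prob_space M by fact
  note [measurable] = \<open>X \<in> borel_measurable M\<close>
  note pos = \<open>0 < \<alpha>\<close> \<open>0 < \<beta>\<close> \<open>0 < p\<close>
  define a where "a = \<alpha> / \<beta>"
  define m where "m = (\<integral>\<omega>. X \<omega> powr \<beta> \<partial>M)"
  \<comment> \<open>The power \<open>\<beta>\<close> turns the \<open>\<beta>\<close>-power bias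
    into the ordinary size bias and the exponent \<alpha> into \<open>a\<close>; the choice of \<mu>
    gives \<open>Z\<close> the mean \<open>a\<close>.\<close>
  define Z where "Z \<omega> = (X \<omega> / \<mu>) powr \<beta>" for \<omega>
  have "0 < a" "0 < m" and ab: "a * \<beta> = \<alpha>"
    using assms by (simp_all add: a_def m_def)
  have "\<mu> = (m / a) powr (1 / \<beta>)"
    using assms by (simp add: a_def m_def mult.commute)
  then have "0 < \<mu>" and \<mu>: "\<mu> powr \<beta> = m / a"
    using \<open>0 < a\<close> \<open>0 < m\<close> pos by (simp_all add: powr_powr)
  have Z: "Z \<omega> = a / m * X \<omega> powr \<beta>" if "0 \<le> X \<omega>" for \<omega>
    using that \<open>0 < \<mu>\<close> by (simp add: Z_def powr_divide \<mu>)
  have Z_meas [measurable]: "Z \<in> borel_measurable M"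
    unfolding Z_def by measurable
  have Z_AE: "AE \<omega> in M. Z \<omega> = a / m * X \<omega> powr \<beta>"
    using \<open>AE \<omega> in M. X \<omega> \<ge> 0\<close> by eventually_elim (rule Z)
  have less_iff: "\<mu> * t < X \<omega> \<longleftrightarrow> t powr \<beta> < Z \<omega>" if "0 < t" "0 \<le> X \<omega>" for t \<omega>
  proof -
    have "\<mu> * t < X \<omega> \<longleftrightarrow> t < X \<omega> / \<mu>"
      using \<open>0 < \<mu>\<close> by (simp add: field_simps)
    also have "\<dots> \<longleftrightarrow> t powr \<beta> < Z \<omega>"
      using that \<open>0 < \<mu>\<close> pos by (simp add: Z_def powr_le_iff_le flip: not_le)
    finally show ?thesis .
  qed
  have le_iff: "\<mu> * t \<le> X \<omega> \<longleftrightarrow> t powr \<beta> \<le> Z \<omega>" if "0 < t" "0 \<le> X \<omega>" for t \<omega>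
  proof -
    have "\<mu> * t \<le> X \<omega> \<longleftrightarrow> t \<le> X \<omega> / \<mu>"
      using \<open>0 < \<mu>\<close> by (simp add: field_simps)
    also have "\<dots> \<longleftrightarrow> t powr \<beta> \<le> Z \<omega>"
      using that \<open>0 < \<mu>\<close> pos by (simp add: Z_def powr_le_iff_le)
    finally show ?thesis .
  qed
  interpret equilibrium_dominated M Z a p
  proof
    show "Z \<in> borel_measurable M" by measurable
    show "AE \<omega> in M. 0 \<le> Z \<omega>" by (simp add: Z_def)
    show "integrable M Z"
      using assms Z_AE by (subst integrable_cong_AE[OF _ _ Z_AE]) auto
    show "expectation Z = a"
      using \<open>0 < m\<close> by (subst integral_cong_AE[OF _ _ Z_AE]) (simp_all add: m_def[symmetric])
    show "0 < a" "0 < p" "p \<le> 1" by fact+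
    fix x :: real assume "0 < x"
    define t where "t = x powr (1 / \<beta>)"
    have "0 < t" and x: "x = t powr \<beta>"
      using \<open>0 < x\<close> pos by (simp_all add: t_def powr_powr)
    \<comment> \<open>Since \<open>a * \<beta> = \<alpha>\<close>, the power
      \<open>(x / Z \<omega>) powr a\<close> is
      \<open>(\<mu> * t / X \<omega>) powr \<alpha>\<close>, so the kernel is a multiple of the
      integrand in \<open>generalized_equilibrium_tail\<close> at level
      \<open>\<mu> * t\<close>.\<close>
    have ex: "excess a x (Z \<omega>) =
        a / m * (X \<omega> powr \<beta> * (if \<mu> * t < X \<omega> then 1 - (\<mu> * t / X \<omega>) powr \<alpha> else 0))"
      if "0 \<le> X \<omega>" for \<omega>
    proof (cases "\<mu> * t < X \<omega>")
      case True
      have "x < Z \<omega>"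
        using True less_iff that \<open>0 < t\<close> by (simp add: x)
      have "0 < X \<omega>"
        using True \<open>0 < t\<close> \<open>0 < \<mu>\<close> by (meson less_trans mult_pos_pos)
      have "excess a x (Z \<omega>) = Z \<omega> * (1 - (x / Z \<omega>) powr a)"
        using \<open>x < Z \<omega>\<close> \<open>0 < x\<close> by (simp add: excess_def powr_divide powr_diff right_diff_distrib)
      also have "x / Z \<omega> = (\<mu> * t / X \<omega>) powr \<beta>"
        using \<open>0 < t\<close> \<open>0 < \<mu>\<close> \<open>0 < X \<omega>\<close> by (simp add: x Z_def powr_divide powr_mult)
      finally show ?thesis
        using True by (simp add: powr_powr ab mult.commute[of \<beta>] Z[OF that])
    next
      case False
      then show ?thesis
        using less_iff[OF \<open>0 < t\<close> that] by (simp add: excess_def x)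
    qed
    have "expectation (\<lambda>\<omega>. excess a x (Z \<omega>)) =
        expectation (\<lambda>\<omega>. a / m * (X \<omega> powr \<beta> * (if \<mu> * t < X \<omega> then 1 - (\<mu> * t / X \<omega>) powr \<alpha> else 0)))"
      using \<open>AE \<omega> in M. X \<omega> \<ge> 0\<close> by (intro integral_cong_AE) (auto elim!: eventually_mono simp: ex)
    also have "\<dots> = a / m * (m * \<P>(\<omega> in N. \<mu> * t < Xstar \<omega>))"
      using generalized_equilibrium_tail[of \<alpha> \<beta> M X N Xstar "\<mu> * t"] assms \<open>0 < t\<close> \<open>0 < \<mu>\<close>
      by (simp add: m_def)
    finally have E: "expectation (\<lambda>\<omega>. excess a x (Z \<omega>)) = a * \<P>(\<omega> in N. \<mu> * t < Xstar \<omega>)"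
      using \<open>0 < m\<close> by simp
    have "p * \<P>(\<omega> in N. \<mu> * t < Xstar \<omega>) \<le> \<P>(\<omega> in M. \<mu> * t < X \<omega>)"
      using \<open>stochastically_dominated p N Xstar M X\<close> \<open>0 < p\<close>
      by (simp add: stochastically_dominated_def field_simps)
    also have "\<dots> = \<P>(\<omega> in M. x < Z \<omega>)"
      using \<open>AE \<omega> in M. X \<omega> \<ge> 0\<close> less_iff[OF \<open>0 < t\<close>]
      by (intro finite_measure_eq_AE) (auto elim!: eventually_mono simp: x)
    finally show "p * expectation (\<lambda>\<omega>. excess a x (Z \<omega>)) \<le> a * \<P>(\<omega> in M. x < Z \<omega>)"
      using \<open>0 < a\<close> by (simp add: E mult.left_commute)
  qed
  have tail: "\<P>(\<omega> in M. X \<omega> \<ge> \<mu> * t) = \<P>(\<omega> in M. t powr \<beta> \<le> Z \<omega>)" if "0 < t" for t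
    using \<open>AE \<omega> in M. X \<omega> \<ge> 0\<close> le_iff[OF that]
    by (intro finite_measure_eq_AE) (auto elim!: eventually_mono)
  show ?thesis
  proof (intro conjI impI allI)
    fix t :: real assume "1 \<le> t"
    then have t: "1 \<le> t powr \<beta>" "(t powr \<beta>) powr a = t powr \<alpha>" "1 \<le> t powr \<alpha>"
      using pos ab by (simp_all add: powr_powr mult.commute ge_one_powr_ge_zero)
    show "\<P>(\<omega> in M. X \<omega> \<ge> \<mu> * t) \<le> t powr \<alpha> * exp (2 - p * t powr \<beta>)"
    \<comment> \<open>For \<open>a \<le> 1\<close> the sharper bound
      \<open>exp (1 - p * t powr \<beta>)\<close> holds, and \<open>t powr \<alpha> \<ge> 1\<close>
      absorbs the difference.\<close>
    proof (cases "a \<le> 1")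
      case True
      have "\<P>(\<omega> in M. X \<omega> \<ge> \<mu> * t) \<le> 1 * exp (1 - p * t powr \<beta>)"
        using tail_bound_le_1[OF True, of "t powr \<beta>"] tail[of t] \<open>1 \<le> t\<close> by simp
      also have "\<dots> \<le> t powr \<alpha> * exp (2 - p * t powr \<beta>)"
        using t by (intro mult_mono) auto
      finally show ?thesis .
    next
      case False
      then show ?thesis
        using tail_bound_ge_1[of "t powr \<beta>"] tail[of t] t \<open>1 \<le> t\<close> by simp
    qed
  next
    fix t :: real assume "\<alpha> = \<beta>" "0 < t"
    then show "\<P>(\<omega> in M. X \<omega> \<ge> \<mu> * t) \<le> exp (1 - p * t powr \<beta>)"
      using tail_bound_le_1[of "t powr \<beta>"] tail[of t] pos by (simp add: a_def)
  qed
qed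

end
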